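(* For all integers $m,n,m',n'\ge 0$ and all $(z,w)\in\mathbb{C}^2$, $$H_{m,n,m',n'}(z,w)=2(-1)^{m'+n}\,e^{|z|^2+|w|^2}\,\mathcal{V}(h_{m,n'},h_{m',n})(2z,2w).$$
   Context: For integers $m,n\ge 0$ and $\zeta\in\mathbb{C}$, $H_{m,n}(\zeta,\overline{\zeta})=(-1)^{m+n}e^{|\zeta|^2}\frac{\partial^{m+n}}{\partial\overline{\zeta}^{m}\partial\zeta^{n}}\left(e^{-|\zeta|^2}\right)$ (Wirtinger derivatives), and for $(z,w)\in\mathbb{C}^2$, $H_{m,n,m',n'}(z,w)=H_{m,n}(z+iw,\overline{z}-i\overline{w})\,H_{m',n'}(\overline{z}+i\overline{w},z-iw)$. The complex Hermite functions are $h_{m,n}(\zeta,\overline{\zeta})=e^{-|\zeta|^2/2}H_{m,n}(\zeta,\overline{\zeta})$, regarded as functions on $\mathbb{R}^2$ via $(t_1,t_2)\leftrightarrow\zeta=t_1+it_2$. The two-dimensional Fourier-Wigner transform of $f,g\in L^2(\mathbb{R}^2)$ is $$\mathcal{V}_2(f,g)(p,q)=\frac{1}{2\pi}\int_{\mathbb{R}^2}e^{i\langle y,q\rangle}f\left(y+\frac p2\right)\overline{g\left(y-\frac p2\right)}\,dy,\qquad p,q\in\mathbb{R}^2,$$ and for complex numbers $z_1=x_1+iy_1$, $z_2=x_2+iy_2$ ($x_\ell,y_\ell\in\mathbb{R}$) one sets $\mathcal{V}(f,g)(z_1,z_2)=\mathcal{V}_2(f,g)((x_1,x_2),(y_1,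y_2))$.
   Formalization: The second function in V is h_{n,m'} (the complex conjugate of h_{m',n}) instead of the printed h_{m',n}; the printed identity fails, e.g. for m=m'=n'=0, n=1, (z,w)=(0,1), where the left side is -i and the right side is i. *)

theory Defs
  imports "HOL-Analysis.Analysis"
begin

definition wirtinger :: "(complex \<Rightarrow> complex) \<Rightarrow> complex \<Rightarrow> complex" where
  "wirtinger f \<zeta> =
     (vector_derivative (\<lambda>t::real. f (Complex t (Im \<zeta>))) (at (Re \<zeta>))
      - \<i> * vector_derivative (\<lambda>t::real. f (Complex (Re \<zeta>) t)) (at (Im \<zeta>))) / 2"

definition wirtinger_bar :: "(complex \<Rightarrow> complex) \<Rightarrow> complex \<Rightarrow> complex" where
  "wirtinger_bar f \<zeta> =
     (vector_derivative (\<lambda>t::real. f (Complex t (Im \<zeta>))) (at (Re \<zeta>))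
      + \<i> * vector_derivative (\<lambda>t::real. f (Complex (Re \<zeta>) t)) (at (Im \<zeta>))) / 2"

text \<open>The polynomial usually written with the two arguments \<open>\<zeta>\<close> and \<open>cnj \<zeta>\<close>. The second argument
  is determined by the first, so it is omitted here.\<close>

definition hermite_poly :: "nat \<Rightarrow> nat \<Rightarrow> complex \<Rightarrow> complex" where
  "hermite_poly m n \<zeta> =
     (-1) ^ (m + n) * complex_of_real (exp ((cmod \<zeta>)\<^sup>2)) *
     (wirtinger_bar ^^ m) ((wirtinger ^^ n) (\<lambda>\<xi>. complex_of_real (exp (- (cmod \<xi>)\<^sup>2)))) \<zeta>"

text \<open>Both factors are of the above form, because \<open>cnj (z + \<i> * w) = cnj z - \<i> * cnj w\<close> and
  \<open>cnj (cnj z + \<i> * cnj w) = z - \<i> * w\<close>.\<close>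

definition hermite_poly2 :: "nat \<Rightarrow> nat \<Rightarrow> nat \<Rightarrow> nat \<Rightarrow> complex \<Rightarrow> complex \<Rightarrow> complex" where
  "hermite_poly2 m n m' n' z w =
     hermite_poly m n (z + \<i> * w) * hermite_poly m' n' (cnj z + \<i> * cnj w)"

definition hermite_fun :: "nat \<Rightarrow> nat \<Rightarrow> complex \<Rightarrow> complex" where
  "hermite_fun m n \<zeta> = complex_of_real (exp (- (cmod \<zeta>)\<^sup>2 / 2)) * hermite_poly m n \<zeta>"

definition on_plane :: "(complex \<Rightarrow> complex) \<Rightarrow> real ^ 2 \<Rightarrow> complex" where
  "on_plane f t = f (Complex (t $ 1) (t $ 2))"

definition fourier_wigner2 ::
    "(real ^ 2 \<Rightarrow> complex) \<Rightarrow> (real ^ 2 \<Rightarrow> complex) \<Rightarrow> real ^ 2 \<Rightarrow> real ^ 2 \<Rightarrow> complex" where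
  "fourier_wigner2 f g p q =
     1 / (2 * complex_of_real pi) *
     (LINT y|lebesgue. exp (\<i> * complex_of_real (y \<bullet> q)) *
        f (y + p /\<^sub>R 2) * cnj (g (y - p /\<^sub>R 2)))"

text \<open>The real parts of \<open>z\<^sub>1, z\<^sub>2\<close> form the first vector and the imaginary parts the second.\<close>

definition fourier_wigner ::
    "(real ^ 2 \<Rightarrow> complex) \<Rightarrow> (real ^ 2 \<Rightarrow> complex) \<Rightarrow> complex \<Rightarrow> complex \<Rightarrow> complex" where
  "fourier_wigner f g z\<^sub>1 z\<^sub>2 =
     fourier_wigner2 f g (vector [Re z\<^sub>1, Re z\<^sub>2]) (vector [Im z\<^sub>1, Im z\<^sub>2])"

end

theory Submission
  imports Defs "HOL-Probability.Characteristic_Functions"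
begin

text \<open>Put \<open>p = Re z + \<i> Re w\<close> and \<open>q = Im z + \<i> Im w\<close>. Completing the square in the two Gaussian factors turns
  the Fourier-Wigner transform into \<open>J f = \<integral> f(\<zeta>) exp (2\<i>\<langle>\<zeta>, q\<rangle> - |\<zeta>|\<^sup>2) d\<zeta>\<close> evaluated at the polynomial
  \<open>H\<^bsub>m,n'\<^esub>(\<zeta> + p) H\<^bsub>m',n\<^esub>(\<zeta> - p)\<close>. Integration by parts gives \<open>J(\<zeta> f) = \<i> q J f + J(\<partial>f/\<partial>cnj \<zeta>)\<close> and its conjugate
  analogue. Since \<open>H\<^bsub>m+1,n\<^esub> = \<zeta> H\<^bsub>m,n\<^esub> - n H\<^bsub>m,n-1\<^esub>\<close> and differentiation lowers the indices, \<open>J\<close> of the product obeys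
  the recurrences of \<open>H\<^bsub>m,n\<^esub>(p + \<i> q) H\<^bsub>m',n'\<^esub>(p - \<i> q)\<close>, up to signs, and \<open>J 1\<close> is the Gaussian Fourier transform.\<close>

subsection \<open>Complex Hermite polynomials\<close>

text \<open>The raising recurrence is taken as the definition, so that induction is available;
  agreement with the Rodrigues formula comes later in \<open>hermite_poly_eq_cherm\<close>. For
  \<open>n = 0\<close> the truncated index \<open>n - 1\<close> is harmless, because its coefficient
  vanishes.\<close>

fun cherm :: "nat \<Rightarrow> nat \<Rightarrow> complex \<Rightarrow> complex" where
  "cherm 0 n \<zeta> = cnj \<zeta> ^ n"
| "cherm (Suc m) n \<zeta> = \<zeta> * cherm m n \<zeta> - of_nat n * cherm m (n - 1) \<zeta>"

lemma cherm_Suc_right: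
  "cherm m (Suc n) \<zeta> = cnj \<zeta> * cherm m n \<zeta> - of_nat m * cherm (m - 1) n \<zeta>"
proof (induction m arbitrary: n)
  case (Suc m)
  \<comment> \<open>Keeping the factor \<open>of_nat m\<close> makes the recurrence at
    \<open>m - 1\<close> valid also for \<open>m = 0\<close>; the next equation does the same for
    \<open>n\<close>.\<close>
  have 1: "of_nat m * (\<zeta> * cherm (m - 1) n \<zeta>) =
      of_nat m * (cherm m n \<zeta> + of_nat n * cherm (m - 1) (n - 1) \<zeta>)"
    by (cases m) auto
  have 2: "of_nat n * cherm m n \<zeta> =
      of_nat n * (cnj \<zeta> * cherm m (n - 1) \<zeta> - of_nat m * cherm (m - 1) (n - 1) \<zeta>)"
    using Suc[of "n - 1"] by (cases n) auto
  have "cherm (Suc m) (Suc n) \<zeta> = \<zeta> * (cnj \<zeta> * cherm m n \<zeta> - of_nat m * cherm (m - 1) n \<zeta>)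
      - (1 + of_nat n) * cherm m n \<zeta>"
    by (simp add: Suc)
  also have "\<dots> = cnj \<zeta> * (\<zeta> * cherm m n \<zeta> - of_nat n * cherm m (n - 1) \<zeta>) - (1 + of_nat m) * cherm m n \<zeta>"
    using 1 2 by (simp add: algebra_simps)
  finally show ?case by simp
qed simp

text \<open>Conjugation exchanges the recurrences in the two indices. This is what keeps the
  conjugated factor of the transform inside the same family.\<close>

lemma cnj_cherm: "cnj (cherm m n \<zeta>) = cherm n m \<zeta>"
proof (induction m arbitrary: n)
  case 0
  show ?case by (induction n) auto
next
  case (Suc m)
  show ?case using cherm_Suc_right[of n m \<zeta>] by (simp add: Suc)
qed

text \<open>The coefficients of \<open>h\<close> and \<open>cnj h\<close> in a real derivative are
  the two Wirtinger derivatives, and each of them lowers one index. All later differentiation uses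
  this normal form.\<close>

lemma has_derivative_cherm:
  "(cherm m n has_derivative (\<lambda>h. of_nat m * cherm (m - 1) n \<zeta> * h + of_nat n * cherm m (n - 1) \<zeta> * cnj h)) (at \<zeta>)"
proof (induction m arbitrary: n)
  case 0
  have "((\<lambda>\<zeta>. cnj \<zeta> ^ n) has_derivative (\<lambda>h. of_nat n * cnj h * cnj \<zeta> ^ (n - 1))) (at \<zeta>)"
    by (rule has_derivative_power) (auto intro: derivative_eq_intros)
  then show ?case by (simp add: mult_ac)
next
  case (Suc m)
  have eq: "of_nat m * (\<zeta> * cherm (m - 1) n \<zeta>) =
      of_nat m * (cherm m n \<zeta> + of_nat n * cherm (m - 1) (n - 1) \<zeta>)" for n
    by (cases m) auto
  have *: "of_nat n * cherm (Suc m) (n - 1) \<zeta> =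
     \<zeta> * (of_nat n * cherm m (n - 1) \<zeta>) - of_nat n * (of_nat (n - 1) * cherm m (n - 1 - 1) \<zeta>)"
    by (simp add: algebra_simps)
  have D: "(cherm (Suc m) n has_derivative
    (\<lambda>h. (\<zeta> * (of_nat m * cherm (m - 1) n \<zeta> * h + of_nat n * cherm m (n - 1) \<zeta> * cnj h) + h * cherm m n \<zeta>) -
      of_nat n * (of_nat m * cherm (m - 1) (n - 1) \<zeta> * h
        + of_nat (n - 1) * cherm m (n - 1 - 1) \<zeta> * cnj h))) (at \<zeta>)"
    unfolding cherm.simps[abs_def]
    by (intro has_derivative_diff has_derivative_mult has_derivative_mult_right Suc has_derivative_ident)
  show ?case
    unfolding * by (rule has_derivative_eq_rhs[OF D], rule ext)
       (use eq[of n] in \<open>simp add: algebra_simps del: cherm.simps\<close>)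
qed

section \<open>Wirtinger derivatives and the Rodrigues formula\<close>

lemma partials_of_has_derivative:
  assumes "(f has_derivative (\<lambda>h. a * h + b * cnj h)) (at (Complex x y))"
  shows "((\<lambda>t. f (Complex t y)) has_vector_derivative (a + b)) (at x)"
    and "((\<lambda>t. f (Complex x t)) has_vector_derivative \<i> * (a - b)) (at y)"
proof -
  have 1: "((\<lambda>t. Complex t y) has_derivative of_real) (at x)"
    unfolding Complex_eq by (auto intro!: derivative_eq_intros)
  show "((\<lambda>t. f (Complex t y)) has_vector_derivative (a + b)) (at x)"
    unfolding has_vector_derivative_def
    by (rule has_derivative_eq_rhs[OF has_derivative_compose[OF 1 assms]])
       (simp add: scaleR_conv_of_real algebra_simps)
  have 2: "((\<lambda>t. Complex x t) has_derivative (\<lambda>h. \<i> * of_real h)) (at y)"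
    unfolding Complex_eq by (auto intro!: derivative_eq_intros)
  show "((\<lambda>t. f (Complex x t)) has_vector_derivative \<i> * (a - b)) (at y)"
    unfolding has_vector_derivative_def
    by (rule has_derivative_eq_rhs[OF has_derivative_compose[OF 2 assms]])
       (simp add: scaleR_conv_of_real algebra_simps)
qed

text \<open>The directions 1 and \<i> give the real partial derivatives \<open>a + b\<close> and
  \<open>\<i> * (a - b)\<close>; the Wirtinger combinations solve this system for \<open>a\<close>
  and \<open>b\<close>.\<close>

lemma wirtinger_of_has_derivative:
  assumes "(f has_derivative (\<lambda>h. a * h + b * cnj h)) (at \<zeta>)"
  shows "wirtinger f \<zeta> = a" and "wirtinger_bar f \<zeta> = b"
proof -
  have "\<i> * (\<i> * (a - b)) = b - a"
    by (simp add: algebra_simps)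
  then show "wirtinger f \<zeta> = a" and "wirtinger_bar f \<zeta> = b"
    using partials_of_has_derivative[of f a b "Re \<zeta>" "Im \<zeta>", THEN vector_derivative_at] assms
    by (simp_all add: wirtinger_def wirtinger_bar_def)
qed

text \<open>The first summand of the exponent is \<open>2\<i>\<langle>\<zeta>, q\<rangle>\<close> for the real inner product on the plane.\<close>

definition gauss_fourier :: "complex \<Rightarrow> complex \<Rightarrow> complex" where
  "gauss_fourier q \<zeta> = exp (\<i> * (\<zeta> * cnj q + cnj \<zeta> * q) - \<zeta> * cnj \<zeta>)"

text \<open>One product rule serves twice: \<open>q = 0\<close> leads to the Rodrigues formula,
  general \<open>q\<close> to integration by parts.\<close>

lemma has_derivative_mult_gauss_fourier:
  assumes "(f has_derivative (\<lambda>h. a * h + b * cnj h)) (at \<zeta>)"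
  shows "((\<lambda>\<zeta>. f \<zeta> * gauss_fourier q \<zeta>) has_derivative
    (\<lambda>h. (a + f \<zeta> * (\<i> * cnj q - cnj \<zeta>)) * gauss_fourier q \<zeta> * h
       + (b + f \<zeta> * (\<i> * q - \<zeta>)) * gauss_fourier q \<zeta> * cnj h)) (at \<zeta>)"
proof -
  have 1: "((\<lambda>\<zeta>. \<i> * (\<zeta> * cnj q + cnj \<zeta> * q) - \<zeta> * cnj \<zeta>) has_derivative
     (\<lambda>h. (\<i> * cnj q - cnj \<zeta>) * h + (\<i> * q - \<zeta>) * cnj h)) (at \<zeta>)"
    by (auto intro!: derivative_eq_intros simp: algebra_simps)
  have "(gauss_fourier q has_derivative
    (\<lambda>h. gauss_fourier q \<zeta> * ((\<i> * cnj q - cnj \<zeta>) * h + (\<i> * q - \<zeta>) * cnj h))) (at \<zeta>)"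
    unfolding gauss_fourier_def[abs_def]
    using has_derivative_compose[OF 1 DERIV_exp[THEN has_field_derivative_imp_has_derivative]] .
  from has_derivative_mult[OF assms this] show ?thesis
    by (rule has_derivative_eq_rhs) (auto simp: algebra_simps)
qed

lemma gauss_fourier_0: "gauss_fourier 0 \<zeta> = complex_of_real (exp (- (cmod \<zeta>)\<^sup>2))"
  unfolding gauss_fourier_def complex_norm_square[symmetric] by (simp add: exp_of_real[symmetric])

text \<open>Each differentiation raises one index and flips the sign. Since
  \<open>hermite_poly\<close> applies all \<open>wirtinger\<close> steps first, these are needed
  only at first index 0, where the polynomial is a power of \<open>cnj \<zeta>\<close>.\<close>

lemma wirtinger_cherm_gauss:
  "wirtinger (\<lambda>\<zeta>. c * (cherm 0 n \<zeta> * gauss_fourier 0 \<zeta>)) =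
    (\<lambda>\<zeta>. - c * (cherm 0 (Suc n) \<zeta> * gauss_fourier 0 \<zeta>))" (is ?A)
  and wirtinger_bar_cherm_gauss:
  "wirtinger_bar (\<lambda>\<zeta>. c * (cherm m n \<zeta> * gauss_fourier 0 \<zeta>)) =
    (\<lambda>\<zeta>. - c * (cherm (Suc m) n \<zeta> * gauss_fourier 0 \<zeta>))" (is ?B)
proof -
  let ?g = "gauss_fourier 0"
  have D: "((\<lambda>\<zeta>. c * (cherm m n \<zeta> * ?g \<zeta>)) has_derivative
     (\<lambda>h. c * ((of_nat m * cherm (m - 1) n \<zeta> - cnj \<zeta> * cherm m n \<zeta>) * ?g \<zeta>) * h +
       c * ((of_nat n * cherm m (n - 1) \<zeta> - \<zeta> * cherm m n \<zeta>) * ?g \<zeta>) * cnj h)) (at \<zeta>)" for m \<zeta>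
    by (rule has_derivative_eq_rhs[OF has_derivative_mult_right
          [OF has_derivative_mult_gauss_fourier[OF has_derivative_cherm]]])
       (simp add: algebra_simps)
  show ?A
    using wirtinger_of_has_derivative(1)[OF D[of 0]] by (simp add: fun_eq_iff)
  show ?B
    using wirtinger_of_has_derivative(2)[OF D[of m]] by (simp add: fun_eq_iff algebra_simps)
qed

lemma hermite_poly_eq_cherm: "hermite_poly m n = cherm m n"
proof
  fix \<zeta> :: complex
  let ?g = "gauss_fourier 0"
  have 1: "(wirtinger ^^ n) ?g = (\<lambda>\<zeta>. (-1) ^ n * (cherm 0 n \<zeta> * ?g \<zeta>))"
    by (induction n) (simp, simp add: wirtinger_cherm_gauss del: cherm.simps)
  have 2: "(wirtinger_bar ^^ m) ((wirtinger ^^ n) ?g) = (\<lambda>\<zeta>. (-1) ^ (m + n) * (cherm m n \<zeta> * ?g \<zeta>))"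
    by (induction m) (simp_all add: 1 wirtinger_bar_cherm_gauss del: cherm.simps)
  have 3: "complex_of_real (exp ((cmod \<zeta>)\<^sup>2)) * ?g \<zeta> = 1"
    by (simp add: gauss_fourier_0 of_real_mult[symmetric] exp_minus del: of_real_mult)
  have "hermite_poly m n \<zeta> = ((-1) ^ (m + n) * (-1) ^ (m + n)) * (complex_of_real (exp ((cmod \<zeta>)\<^sup>2)) * ?g \<zeta>) * cherm m n \<zeta>"
    unfolding hermite_poly_def gauss_fourier_0[symmetric] 2 by (simp only: mult_ac)
  then show "hermite_poly m n \<zeta> = cherm m n \<zeta>"
    unfolding 3 by (simp add: power_add[symmetric] flip: mult_2)
qed

subsection \<open>Integration of functions with Gaussian decay over the plane\<close>

lemma integrable_exp_neg_half_square: "integrable lborel (\<lambda>x::real. exp (- x\<^sup>2 / 2))"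
proof -
  have "(\<lambda>x::real. exp (- x\<^sup>2 / 2)) = (\<lambda>x. sqrt (2 * pi) * std_normal_density x)"
    by (simp add: std_normal_density_def fun_eq_iff)
  then show ?thesis by simp
qed

lemma exp_neg_half_square_tendsto_0:
  "((\<lambda>x::real. C * exp (- x\<^sup>2 / 2)) \<longlongrightarrow> 0) at_top"
  "((\<lambda>x::real. C * exp (- x\<^sup>2 / 2)) \<longlongrightarrow> 0) at_bot"
  by real_asymp+

text \<open>The fundamental theorem of calculus on the whole line: the bound on \<open>f'\<close>
  gives integrability, the bound on \<open>f\<close> makes both boundary terms vanish.\<close>

lemma integral_of_gaussian_decay_derivative:
  fixes f f' :: "real \<Rightarrow> complex"
  assumes D: "\<And>x. (f has_vector_derivative f' x) (at x)"
    and cont: "continuous_on UNIV f'"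
    and f: "\<And>x. cmod (f x) \<le> C * exp (- x\<^sup>2 / 2)"
    and f': "\<And>x. cmod (f' x) \<le> C * exp (- x\<^sup>2 / 2)"
  shows "integral\<^sup>L lborel f' = 0"
proof -
  have int: "integrable lborel f'"
    by (rule Bochner_Integration.integrable_bound[OF integrable_mult_right[OF integrable_exp_neg_half_square, of C]])
      (use cont f' in \<open>auto intro!: borel_measurable_continuous_onI intro: order_trans[OF _ abs_ge_self]\<close>)
  have top: "(f \<longlongrightarrow> 0) at_top" and bot: "(f \<longlongrightarrow> 0) at_bot"
    by (rule Lim_null_comparison[OF always_eventually exp_neg_half_square_tendsto_0(1)],
        use f in blast)
      (rule Lim_null_comparison[OF always_eventually exp_neg_half_square_tendsto_0(2)],
        use f in blast)
  have "(LBINT x=-\<infinity>..\<infinity>. f' x) = 0 - 0"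
  proof (rule interval_integral_FTC_integrable)
    show "isCont f' x" for x
      using cont by (simp add: continuous_on_eq_continuous_at)
    show "((f \<circ> real_of_ereal) \<longlongrightarrow> 0) (at_right (- \<infinity>))" "((f \<circ> real_of_ereal) \<longlongrightarrow> 0) (at_left \<infinity>)"
      using top bot by (simp_all add: ereal_tendsto_simps)
  qed (use D int in \<open>auto simp: set_integrable_def\<close>)
  then show ?thesis
    by (simp add: interval_lebesgue_integral_def set_lebesgue_integral_def)
qed

text \<open>The rate 1/2 is half that of \<open>gauss_fourier\<close>, which leaves room for
  polynomial factors. The bound splits into a product over the coordinates, as Fubini
  requires.\<close>

definition gauss_decay :: "(complex \<Rightarrow> complex) \<Rightarrow> bool" where
  "gauss_decay g \<longleftrightarrow> continuous_on UNIV g \<and> (\<exists>C. \<forall>\<zeta>. cmod (g \<zeta>) \<le> C * exp (- (cmod \<zeta>)\<^sup>2 / 2))"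

lemma gauss_decay_bound_mono:
  assumes "\<And>\<zeta>. cmod (g \<zeta>) \<le> C * exp (- (cmod \<zeta>)\<^sup>2 / 2)" "C \<le> C'"
  shows "cmod (g \<zeta>) \<le> C' * exp (- (cmod \<zeta>)\<^sup>2 / 2)"
  by (rule order_trans[OF assms(1)]) (use assms(2) in auto)

lemma gauss_decay_add:
  assumes "gauss_decay f" "gauss_decay g"
  shows "gauss_decay (\<lambda>\<zeta>. f \<zeta> + g \<zeta>)"
proof -
  obtain C D where "\<And>\<zeta>. cmod (f \<zeta>) \<le> C * exp (- (cmod \<zeta>)\<^sup>2 / 2)" "\<And>\<zeta>. cmod (g \<zeta>) \<le> D * exp (- (cmod \<zeta>)\<^sup>2 / 2)"
    using assms by (auto simp: gauss_decay_def)
  then have "cmod (f \<zeta> + g \<zeta>) \<le> (C + D) * exp (- (cmod \<zeta>)\<^sup>2 / 2)" for \<zeta>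
    by (smt (verit) distrib_right norm_triangle_ineq)
  then show ?thesis
    using assms by (auto simp: gauss_decay_def intro!: continuous_on_add)
qed

lemma gauss_decay_cmult:
  assumes "gauss_decay f"
  shows "gauss_decay (\<lambda>\<zeta>. c * f \<zeta>)"
proof -
  obtain C where C: "\<And>\<zeta>. cmod (f \<zeta>) \<le> C * exp (- (cmod \<zeta>)\<^sup>2 / 2)"
    using assms by (auto simp: gauss_decay_def)
  have "cmod (c * f \<zeta>) \<le> (cmod c * C) * exp (- (cmod \<zeta>)\<^sup>2 / 2)" for \<zeta>
    using mult_left_mono[OF C[of \<zeta>], of "cmod c"] by (simp add: norm_mult mult.assoc)
  then show ?thesis
    using assms by (auto simp: gauss_decay_def intro!: continuous_on_mult_left)
qed

definition plane_integral :: "(complex \<Rightarrow> complex) \<Rightarrow> complex" where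
  "plane_integral g = (LINT p|(lborel \<Otimes>\<^sub>M lborel). g (Complex (fst p) (snd p)))"

lemma integrable_exp_neg_half_square_pair:
  "integrable (lborel \<Otimes>\<^sub>M lborel) (\<lambda>p::real \<times> real. exp (- (fst p)\<^sup>2 / 2) * exp (- (snd p)\<^sup>2 / 2))"
proof (rule lborel_pair.Fubini_integrable)
  show "AE x in lborel. integrable lborel (\<lambda>y. exp (- (fst (x, y :: real))\<^sup>2 / 2) * exp (- (snd (x :: real, y))\<^sup>2 / 2))"
    using integrable_exp_neg_half_square by auto
  show "integrable lborel (\<lambda>x. LINT y|lborel. norm (exp (- (fst (x, y :: real))\<^sup>2 / 2) * exp (- (snd (x :: real, y))\<^sup>2 / 2)))"
    using integrable_exp_neg_half_square by auto
qed measurable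

lemma continuous_Complex [continuous_intros]:
  "continuous_on A f \<Longrightarrow> continuous_on A g \<Longrightarrow> continuous_on A (\<lambda>x. Complex (f x) (g x))"
  unfolding Complex_eq by (intro continuous_intros)

lemma measurable_on_plane:
  assumes "continuous_on UNIV g"
  shows "(\<lambda>p. g (Complex (fst p) (snd p))) \<in> borel_measurable (lborel \<Otimes>\<^sub>M lborel)"
proof -
  have "continuous_on UNIV (\<lambda>p. g (Complex (fst p) (snd p)))"
    by (rule continuous_on_compose2[OF assms]) (auto intro!: continuous_intros)
  then show ?thesis
    unfolding lborel_prod by (simp add: borel_measurable_continuous_onI)
qed

lemma gauss_decay_integrable:
  assumes "gauss_decay g"
  shows "integrable (lborel \<Otimes>\<^sub>M lborel) (\<lambda>p. g (Complex (fst p) (snd p)))"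
proof -
  obtain C where C: "\<And>\<zeta>. cmod (g \<zeta>) \<le> C * exp (- (cmod \<zeta>)\<^sup>2 / 2)"
    using assms by (auto simp: gauss_decay_def)
  have "cmod (g (Complex x y)) \<le> C * (exp (- x\<^sup>2 / 2) * exp (- y\<^sup>2 / 2))" for x y
    using C[of "Complex x y"] by (simp add: cmod_power2 exp_add[symmetric] add_divide_distrib diff_divide_distrib)
  then show ?thesis
    by (intro Bochner_Integration.integrable_bound[OF integrable_mult_right[OF integrable_exp_neg_half_square_pair, of C]])
      (use assms in \<open>auto intro!: measurable_on_plane intro: order_trans[OF _ abs_ge_self] simp: gauss_decay_def\<close>)
qed

lemma plane_integral_add:
  "gauss_decay f \<Longrightarrow> gauss_decay g \<Longrightarrow>
    plane_integral (\<lambda>\<zeta>. f \<zeta> + g \<zeta>) = plane_integral f + plane_integral g"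
  by (simp add: plane_integral_def gauss_decay_integrable)

lemma plane_integral_cmult: "plane_integral (\<lambda>\<zeta>. c * f \<zeta>) = c * plane_integral f"
  by (simp add: plane_integral_def)

lemma plane_integral_iterated:
  assumes "gauss_decay g"
  shows "plane_integral g = (LINT x|lborel. LINT y|lborel. g (Complex x y))"
    and "plane_integral g = (LINT y|lborel. LINT x|lborel. g (Complex x y))"
  using lborel_pair.integral_fst'[OF gauss_decay_integrable[OF assms]]
    lborel_pair.integral_snd[of "\<lambda>x y. g (Complex x y)"] gauss_decay_integrable[OF assms]
  by (simp_all add: plane_integral_def case_prod_unfold)

text \<open>By Fubini the differentiated variable can be integrated first, and that inner integral
  is already 0.\<close>

lemma plane_integral_partials_0:
  assumes f: "gauss_decay f" and "gauss_decay f'"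
  shows "(\<And>x y. ((\<lambda>t. f (Complex t y)) has_vector_derivative f' (Complex x y)) (at x)) \<Longrightarrow> plane_integral f' = 0"
    and "(\<And>x y. ((\<lambda>t. f (Complex x t)) has_vector_derivative f' (Complex x y)) (at y)) \<Longrightarrow> plane_integral f' = 0"
proof -
  obtain C1 C2 where C1: "\<And>\<zeta>. cmod (f \<zeta>) \<le> C1 * exp (- (cmod \<zeta>)\<^sup>2 / 2)"
      and C2: "\<And>\<zeta>. cmod (f' \<zeta>) \<le> C2 * exp (- (cmod \<zeta>)\<^sup>2 / 2)"
    using assms by (auto simp: gauss_decay_def)
  \<comment> \<open>The 0 makes \<open>C\<close> nonnegative, so that dropping one coordinate from
    the exponent only enlarges the bound.\<close>
  define C where "C = max 0 (max C1 C2)"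
  have C: "cmod (f \<zeta>) \<le> C * exp (- (cmod \<zeta>)\<^sup>2 / 2)" "cmod (f' \<zeta>) \<le> C * exp (- (cmod \<zeta>)\<^sup>2 / 2)" for \<zeta>
    by (rule gauss_decay_bound_mono[OF C1] gauss_decay_bound_mono[OF C2], simp add: C_def)+
  have *: "C * exp (- (cmod (Complex x y))\<^sup>2 / 2) \<le> C * exp (- x\<^sup>2 / 2)"
     "C * exp (- (cmod (Complex x y))\<^sup>2 / 2) \<le> C * exp (- y\<^sup>2 / 2)" for x y
    by (auto intro!: mult_left_mono simp: C_def cmod_power2)
  have cont: "continuous_on UNIV f'"
    using assms by (simp add: gauss_decay_def)
  {
    assume D: "\<And>x y. ((\<lambda>t. f (Complex t y)) has_vector_derivative f' (Complex x y)) (at x)"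
    have "(LINT x|lborel. f' (Complex x y)) = 0" for y
      by (rule integral_of_gaussian_decay_derivative[OF D continuous_on_compose2[OF cont]
            order_trans[OF C(1) *(1)] order_trans[OF C(2) *(1)]]) (auto intro!: continuous_intros)
    then show "plane_integral f' = 0"
      using plane_integral_iterated[OF assms(2)] by simp
  next
    assume D: "\<And>x y. ((\<lambda>t. f (Complex x t)) has_vector_derivative f' (Complex x y)) (at y)"
    have "(LINT y|lborel. f' (Complex x y)) = 0" for x
      by (rule integral_of_gaussian_decay_derivative[OF D continuous_on_compose2[OF cont]
            order_trans[OF C(1) *(2)] order_trans[OF C(2) *(2)]]) (auto intro!: continuous_intros)
    then show "plane_integral f' = 0"
      using plane_integral_iterated[OF assms(2)] by simp
  }
qed

section \<open>Transfer of integrals from \<open>real ^ 2\<close> to the product plane\<close>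

lemma continuous_on_vector2: "continuous_on UNIV (\<lambda>p. vector [fst p, snd p] :: real ^ 2)"
proof -
  have "(\<lambda>p. vector [fst p, snd p] :: real ^ 2) = (\<lambda>p. \<chi> i. if i = 1 then fst p else snd p)"
    by (auto simp: fun_eq_iff vec_eq_iff forall_2)
  moreover have "continuous_on UNIV (\<lambda>p :: real \<times> real. if i = 1 then fst p else snd p)" for i :: 2
    by (cases "i = 1") (auto intro!: continuous_intros)
  ultimately show ?thesis
    by (simp only: continuous_on_vec_lambda)
qed

text \<open>Lebesgue measure is determined by its values on boxes, and the preimage of a box is a
  rectangle with the same side lengths.\<close>

lemma lborel_real2: "lborel = distr (lborel \<Otimes>\<^sub>M lborel) borel (\<lambda>p. vector [fst p, snd p] :: real ^ 2)"
proof (rule lborel_eqI)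
  let ?v = "\<lambda>p. vector [fst p, snd p] :: real ^ 2"
  have meas [measurable]: "?v \<in> borel_measurable (lborel \<Otimes>\<^sub>M lborel)"
    unfolding lborel_prod by (simp add: borel_measurable_continuous_onI continuous_on_vector2)
  fix l u :: "real ^ 2"
  assume lu: "\<And>b. b \<in> Basis \<Longrightarrow> l \<bullet> b \<le> u \<bullet> b"
  have B: "(Basis :: (real^2) set) = {axis 1 1, axis 2 1}"
    by (auto simp: Basis_vec_def UNIV_2)
  have ne: "axis 1 1 \<noteq> (axis 2 1 :: real^2)"
    by (simp add: axis_eq_axis)
  have "?v -` box l u = box (l $ 1) (u $ 1) \<times> box (l $ 2) (u $ 2)"
    by (auto simp: mem_box_cart forall_2 box_real)
  moreover have "l $ 1 \<le> u $ 1" "l $ 2 \<le> u $ 2"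
    using lu[of "axis 1 1"] lu[of "axis 2 1"] by (auto simp: B inner_axis)
  ultimately show "emeasure (distr (lborel \<Otimes>\<^sub>M lborel) borel ?v) (box l u) = ennreal (\<Prod>b\<in>Basis. (u - l) \<bullet> b)"
    by (simp add: emeasure_distr space_pair_measure lborel.emeasure_pair_measure_Times B ne inner_axis ennreal_mult)
qed simp

lemma lebesgue_integral_on_plane:
  assumes "continuous_on UNIV g"
  shows "(LINT y|lebesgue. on_plane g y) = plane_integral g"
proof -
  have "continuous_on UNIV (on_plane g)"
    unfolding on_plane_def[abs_def]
    by (rule continuous_on_compose2[OF assms]) (auto intro!: continuous_intros)
  then have meas: "on_plane g \<in> borel_measurable borel"
    by (rule borel_measurable_continuous_onI)
  have v: "(\<lambda>p. vector [fst p, snd p] :: real ^ 2) \<in> borel_measurable (lborel \<Otimes>\<^sub>M lborel)"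
    unfolding lborel_prod by (simp add: borel_measurable_continuous_onI continuous_on_vector2)
  have "(LINT y|lebesgue. on_plane g y) = (LINT y|lborel. on_plane g y)"
    using meas by (intro integral_completion) simp
  also have "\<dots> = (LINT p|(lborel \<Otimes>\<^sub>M lborel). on_plane g (vector [fst p, snd p]))"
    by (subst lborel_real2, rule integral_distr[OF v meas])
  finally show ?thesis
    by (simp add: on_plane_def plane_integral_def)
qed

subsection \<open>Gaussian integration by parts\<close>

text \<open>Demanding a bound for every rate \<open>e > 0\<close> makes the class closed under
  products, since \<open>e\<close> can be halved between the factors. It contains all polynomials in
  \<open>\<zeta>\<close> and \<open>cnj \<zeta>\<close>.\<close>

definition gauss_tempered :: "(complex \<Rightarrow> complex) \<Rightarrow> bool" where
  "gauss_tempered f \<longleftrightarrow> continuous_on UNIV f \<and>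
     (\<forall>e>0. \<exists>C. \<forall>\<zeta>. cmod (f \<zeta>) \<le> C * exp (e * (cmod \<zeta>)\<^sup>2))"

lemma gauss_tempered_const: "gauss_tempered (\<lambda>_. c)"
  unfolding gauss_tempered_def
  by (auto intro!: exI[of _ "cmod c"] simp: mult_le_cancel_left1)

text \<open>The constant comes from |\<zeta>| \<le> 1 + |\<zeta>|^2, where 1 is at most the
  exponential and |\<zeta>|^2 is at most 1/e times it.\<close>

lemma cmod_le_exp:
  assumes "0 < e"
  shows "cmod \<zeta> \<le> (1 + 1 / e) * exp (e * (cmod \<zeta>)\<^sup>2)"
proof -
  have "cmod \<zeta> \<le> 1 + (cmod \<zeta>)\<^sup>2"
    by (smt (verit) power2_eq_square self_le_power zero_le_power2 pos2 norm_ge_zero)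
  moreover have "(cmod \<zeta>)\<^sup>2 = (1 / e) * (e * (cmod \<zeta>)\<^sup>2)"
    using assms by simp
  moreover have "\<dots> \<le> (1 / e) * exp (e * (cmod \<zeta>)\<^sup>2)"
    using assms exp_ge_add_one_self[of "e * (cmod \<zeta>)\<^sup>2"] by (intro mult_left_mono) (linarith, simp)
  moreover have "1 \<le> exp (e * (cmod \<zeta>)\<^sup>2)"
    using assms by simp
  ultimately show ?thesis
    unfolding distrib_right by linarith
qed

lemma gauss_tempered_ident: "gauss_tempered (\<lambda>\<zeta>. \<zeta>)"
  unfolding gauss_tempered_def using cmod_le_exp by (blast intro: continuous_on_id)

lemma gauss_tempered_cnj: "gauss_tempered cnj"
  using gauss_tempered_ident by (auto simp: gauss_tempered_def intro: continuous_intros)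

lemma gauss_tempered_add:
  assumes "gauss_tempered f" "gauss_tempered g"
  shows "gauss_tempered (\<lambda>\<zeta>. f \<zeta> + g \<zeta>)"
  unfolding gauss_tempered_def
proof safe
  show "continuous_on UNIV (\<lambda>\<zeta>. f \<zeta> + g \<zeta>)"
    using assms by (auto simp: gauss_tempered_def intro!: continuous_on_add)
  fix e :: real assume "0 < e"
  then obtain C D where "\<And>\<zeta>. cmod (f \<zeta>) \<le> C * exp (e * (cmod \<zeta>)\<^sup>2)" "\<And>\<zeta>. cmod (g \<zeta>) \<le> D * exp (e * (cmod \<zeta>)\<^sup>2)"
    using assms unfolding gauss_tempered_def by meson
  then have "cmod (f \<zeta> + g \<zeta>) \<le> (C + D) * exp (e * (cmod \<zeta>)\<^sup>2)" for \<zeta>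
    by (smt (verit) distrib_right norm_triangle_ineq)
  then show "\<exists>C. \<forall>\<zeta>. cmod (f \<zeta> + g \<zeta>) \<le> C * exp (e * (cmod \<zeta>)\<^sup>2)"
    by blast
qed

lemma gauss_tempered_mult:
  assumes "gauss_tempered f" "gauss_tempered g"
  shows "gauss_tempered (\<lambda>\<zeta>. f \<zeta> * g \<zeta>)"
  unfolding gauss_tempered_def
proof safe
  show "continuous_on UNIV (\<lambda>\<zeta>. f \<zeta> * g \<zeta>)"
    using assms by (auto simp: gauss_tempered_def intro!: continuous_on_mult)
  fix e :: real assume "0 < e"
  then obtain C D where C: "\<And>\<zeta>. cmod (f \<zeta>) \<le> C * exp (e / 2 * (cmod \<zeta>)\<^sup>2)"
      and D: "\<And>\<zeta>. cmod (g \<zeta>) \<le> D * exp (e / 2 * (cmod \<zeta>)\<^sup>2)"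
    using assms unfolding gauss_tempered_def by (meson half_gt_zero)
  have "cmod (f \<zeta> * g \<zeta>) \<le> (C * D) * exp (e * (cmod \<zeta>)\<^sup>2)" for \<zeta>
  proof -
    have "cmod (f \<zeta> * g \<zeta>) \<le> (C * exp (e / 2 * (cmod \<zeta>)\<^sup>2)) * (D * exp (e / 2 * (cmod \<zeta>)\<^sup>2))"
      unfolding norm_mult using C D by (intro mult_mono order_trans[OF norm_ge_zero C]) auto
    also have "\<dots> = (C * D) * (exp (e / 2 * (cmod \<zeta>)\<^sup>2) * exp (e / 2 * (cmod \<zeta>)\<^sup>2))"
      by (simp only: mult_ac)
    finally show ?thesis
      by (simp flip: exp_add)
  qed
  then show "\<exists>C. \<forall>\<zeta>. cmod (f \<zeta> * g \<zeta>) \<le> C * exp (e * (cmod \<zeta>)\<^sup>2)"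
    by blast
qed

lemma gauss_tempered_diff:
  assumes "gauss_tempered f" "gauss_tempered g"
  shows "gauss_tempered (\<lambda>\<zeta>. f \<zeta> - g \<zeta>)"
  using gauss_tempered_add[OF assms(1) gauss_tempered_mult[OF gauss_tempered_const[of "-1"] assms(2)]]
  by simp

lemma gauss_tempered_power: "gauss_tempered f \<Longrightarrow> gauss_tempered (\<lambda>\<zeta>. f \<zeta> ^ n)"
  by (induction n) (auto intro: gauss_tempered_const gauss_tempered_mult)

lemmas gauss_tempered_intros = gauss_tempered_const gauss_tempered_ident gauss_tempered_cnj
  gauss_tempered_add gauss_tempered_mult gauss_tempered_diff gauss_tempered_power

lemma gauss_tempered_cherm: "gauss_tempered (\<lambda>\<zeta>. cherm m n (\<zeta> + p))"
  by (induction m arbitrary: n) (auto intro!: gauss_tempered_intros)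

lemma norm_gauss_fourier: "cmod (gauss_fourier q \<zeta>) = exp (- (cmod \<zeta>)\<^sup>2)"
  by (simp add: gauss_fourier_def cmod_power2) (simp add: power2_eq_square)

lemma gauss_decay_mult_gauss_fourier:
  assumes "gauss_tempered f"
  shows "gauss_decay (\<lambda>\<zeta>. f \<zeta> * gauss_fourier q \<zeta>)"
proof -
  obtain C where C: "\<And>\<zeta>. cmod (f \<zeta>) \<le> C * exp (1 / 2 * (cmod \<zeta>)\<^sup>2)"
    using assms unfolding gauss_tempered_def by (meson half_gt_zero zero_less_one)
  have "cmod (f \<zeta> * gauss_fourier q \<zeta>) \<le> C * exp (- (cmod \<zeta>)\<^sup>2 / 2)" for \<zeta>
  proof -
    have "cmod (f \<zeta> * gauss_fourier q \<zeta>) \<le> (C * exp (1 / 2 * (cmod \<zeta>)\<^sup>2)) * exp (- (cmod \<zeta>)\<^sup>2)"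
      unfolding norm_mult norm_gauss_fourier by (intro mult_right_mono C) simp
    also have "\<dots> = C * exp (- (cmod \<zeta>)\<^sup>2 / 2)"
      by (simp add: mult.assoc exp_add[symmetric])
    finally show ?thesis .
  qed
  moreover have "continuous_on UNIV (\<lambda>\<zeta>. f \<zeta> * gauss_fourier q \<zeta>)"
    using assms unfolding gauss_tempered_def gauss_fourier_def by (auto intro!: continuous_intros)
  ultimately show ?thesis
    by (auto simp: gauss_decay_def)
qed

definition gauss_functional :: "complex \<Rightarrow> (complex \<Rightarrow> complex) \<Rightarrow> complex" where
  "gauss_functional q f = plane_integral (\<lambda>\<zeta>. f \<zeta> * gauss_fourier q \<zeta>)"

lemma gauss_functional_add:
  "gauss_tempered f \<Longrightarrow> gauss_tempered g \<Longrightarrow>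
    gauss_functional q (\<lambda>\<zeta>. f \<zeta> + g \<zeta>) = gauss_functional q f + gauss_functional q g"
  by (simp add: gauss_functional_def distrib_right plane_integral_add gauss_decay_mult_gauss_fourier)

lemma gauss_functional_cmult: "gauss_functional q (\<lambda>\<zeta>. c * f \<zeta>) = c * gauss_functional q f"
  by (simp add: gauss_functional_def mult.assoc plane_integral_cmult)

lemma gauss_functional_diff:
  "gauss_tempered f \<Longrightarrow> gauss_tempered g \<Longrightarrow>
    gauss_functional q (\<lambda>\<zeta>. f \<zeta> - g \<zeta>) = gauss_functional q f - gauss_functional q g"
  using gauss_functional_add[of f "\<lambda>\<zeta>. -1 * g \<zeta>" q] gauss_functional_cmult[of q "-1" g]
    gauss_tempered_mult[OF gauss_tempered_const[of "-1"], of g]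
  by simp

lemma gauss_functional_by_parts:
  assumes f: "gauss_tempered f" and a: "gauss_tempered a" and b: "gauss_tempered b"
    and D: "\<And>\<zeta>. (f has_derivative (\<lambda>h. a \<zeta> * h + b \<zeta> * cnj h)) (at \<zeta>)"
  shows "gauss_functional q (\<lambda>\<zeta>. \<zeta> * f \<zeta>) = \<i> * q * gauss_functional q f + gauss_functional q b"
    and "gauss_functional q (\<lambda>\<zeta>. cnj \<zeta> * f \<zeta>) = \<i> * cnj q * gauss_functional q f + gauss_functional q a"
proof -
  let ?a = "\<lambda>\<zeta>. (a \<zeta> + (\<i> * cnj q * f \<zeta> - cnj \<zeta> * f \<zeta>)) * gauss_fourier q \<zeta>"
  let ?b = "\<lambda>\<zeta>. (b \<zeta> + (\<i> * q * f \<zeta> - \<zeta> * f \<zeta>)) * gauss_fourier q \<zeta>"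
  let ?f = "\<lambda>\<zeta>. f \<zeta> * gauss_fourier q \<zeta>"
  have "(?f has_derivative (\<lambda>h. ?a \<zeta> * h + ?b \<zeta> * cnj h)) (at \<zeta>)" for \<zeta>
    by (rule has_derivative_eq_rhs[OF has_derivative_mult_gauss_fourier[OF D]]) (simp add: algebra_simps)
  note P = partials_of_has_derivative[OF this]
  have t: "gauss_tempered (\<lambda>\<zeta>. a \<zeta> + (\<i> * cnj q * f \<zeta> - cnj \<zeta> * f \<zeta>))"
    "gauss_tempered (\<lambda>\<zeta>. b \<zeta> + (\<i> * q * f \<zeta> - \<zeta> * f \<zeta>))"
    by (intro gauss_tempered_intros f a b)+
  have da: "gauss_decay ?a" and db: "gauss_decay ?b" and df: "gauss_decay ?f"
    by (intro gauss_decay_mult_gauss_fourier t f)+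
  have nb: "gauss_decay (\<lambda>\<zeta>. -1 * ?b \<zeta>)"
    by (rule gauss_decay_cmult[OF db])
  \<comment> \<open>The two real partial derivatives of \<open>?f\<close> are \<open>?a + ?b\<close>
    and \<open>\<i> * (?a - ?b)\<close>. Both have integral 0, hence so do \<open>?a\<close> and
    \<open>?b\<close> separately.\<close>
  have "plane_integral (\<lambda>\<zeta>. ?a \<zeta> + ?b \<zeta>) = 0"
    by (rule plane_integral_partials_0(1)[OF df gauss_decay_add[OF da db]]) (rule P(1))
  then have 1: "plane_integral ?a + plane_integral ?b = 0"
    by (simp only: plane_integral_add[OF da db])
  have "plane_integral (\<lambda>\<zeta>. \<i> * (?a \<zeta> + -1 * ?b \<zeta>)) = 0"
    by (rule plane_integral_partials_0(2)[OF df gauss_decay_cmult[OF gauss_decay_add[OF da nb]]])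
      (rule has_vector_derivative_eq_rhs[OF P(2)], simp)
  then have 2: "plane_integral ?a - plane_integral ?b = 0"
    by (simp only: plane_integral_cmult plane_integral_add[OF da nb]) simp
  from 1 2 have "plane_integral ?a = 0" "plane_integral ?b = 0"
    by auto
  then have "gauss_functional q (\<lambda>\<zeta>. a \<zeta> + (\<i> * cnj q * f \<zeta> - cnj \<zeta> * f \<zeta>)) = 0"
    "gauss_functional q (\<lambda>\<zeta>. b \<zeta> + (\<i> * q * f \<zeta> - \<zeta> * f \<zeta>)) = 0"
    by (simp_all add: gauss_functional_def)
  then show "gauss_functional q (\<lambda>\<zeta>. \<zeta> * f \<zeta>) = \<i> * q * gauss_functional q f + gauss_functional q b"
    "gauss_functional q (\<lambda>\<zeta>. cnj \<zeta> * f \<zeta>) = \<i> * cnj q * gauss_functional q f + gauss_functional q a"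
    by (simp_all add: gauss_functional_add gauss_functional_diff gauss_functional_cmult f a b
        gauss_tempered_intros add_eq_0_iff2)
qed

text \<open>This is the characteristic function of the standard normal law at
  \<open>sqrt 2 * s\<close>, after the substitution of \<open>sqrt 2 * x\<close> for the
  variable.\<close>

lemma integral_gauss_fourier_1d:
  "(LINT x|lborel. exp (2 * \<i> * of_real (s * x) - of_real (x\<^sup>2))) = complex_of_real (sqrt pi * exp (- s\<^sup>2))"
proof -
  have "complex_of_real (exp (- s\<^sup>2)) = char std_normal_distribution (sqrt 2 * s)"
    by (simp add: char_std_normal_distribution power_mult_distrib)
  also have "\<dots> = (LINT x|lborel. std_normal_density x *\<^sub>R exp (\<i> * of_real (sqrt 2 * s * x)))"
    unfolding char_def by (subst integral_density) auto
  also have "\<dots> = sqrt 2 *\<^sub>R (LINT x|lborel. std_normal_density (sqrt 2 * x) *\<^sub>R exp (\<i> * of_real (sqrt 2 * s * (sqrt 2 * x))))"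
    by (subst lborel_integral_real_affine[where c = "sqrt 2" and t = 0]) auto
  also have "(\<lambda>x. std_normal_density (sqrt 2 * x) *\<^sub>R exp (\<i> * of_real (sqrt 2 * s * (sqrt 2 * x)))) =
      (\<lambda>x. of_real (1 / sqrt (2 * pi)) * exp (2 * \<i> * of_real (s * x) - of_real (x\<^sup>2)))"
    by (auto simp: fun_eq_iff std_normal_density_def scaleR_conv_of_real power_mult_distrib
        exp_diff exp_minus field_simps simp flip: exp_of_real)
  also have "sqrt 2 *\<^sub>R (LINT x|lborel. of_real (1 / sqrt (2 * pi)) * exp (2 * \<i> * of_real (s * x) - of_real (x\<^sup>2))) =
      of_real (sqrt 2 * (1 / sqrt (2 * pi))) * (LINT x|lborel. exp (2 * \<i> * of_real (s * x) - of_real (x\<^sup>2)))"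
    by (simp only: integral_mult_right_zero scaleR_conv_of_real of_real_mult mult.assoc)
  also have "sqrt 2 * (1 / sqrt (2 * pi)) = inverse (sqrt pi)"
    by (simp add: real_sqrt_mult field_simps)
  finally have "of_real (sqrt pi) * complex_of_real (exp (- s\<^sup>2)) =
    of_real (sqrt pi * inverse (sqrt pi)) * (LINT x|lborel. exp (2 * \<i> * of_real (s * x) - of_real (x\<^sup>2)))"
    by (simp only: of_real_mult mult.assoc)
  then show ?thesis
    by simp
qed

lemma gauss_functional_1: "gauss_functional q (\<lambda>_. 1) = complex_of_real (pi * exp (- (cmod q)\<^sup>2))"
proof -
  have *: "gauss_fourier q (Complex x y) = exp (2 * \<i> * of_real (Re q * x) - of_real (x\<^sup>2)) *
     exp (2 * \<i> * of_real (Im q * y) - of_real (y\<^sup>2))" for x y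
    unfolding gauss_fourier_def exp_add[symmetric]
    by (rule arg_cong[of _ _ exp]) (simp add: complex_eq_iff power2_eq_square)
  have "gauss_functional q (\<lambda>_. 1) = complex_of_real (sqrt pi * exp (- (Re q)\<^sup>2)) * complex_of_real (sqrt pi * exp (- (Im q)\<^sup>2))"
    using plane_integral_iterated(1)[OF gauss_decay_mult_gauss_fourier[OF gauss_tempered_const[of 1]], of q]
    by (simp only: gauss_functional_def * integral_gauss_fourier_1d mult_1_left
        integral_mult_right_zero integral_mult_left_zero)
  also have "\<dots> = complex_of_real ((sqrt pi * sqrt pi) * (exp (- (Re q)\<^sup>2) * exp (- (Im q)\<^sup>2)))"
    by (simp only: of_real_mult mult_ac)
  finally show ?thesis
    by (simp add: cmod_power2 exp_add[symmetric] del: of_real_mult)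
qed

subsection \<open>The Gaussian integral of a product of Hermite polynomials\<close>

text \<open>The polynomial part of the integrand: at the doubled arguments \<open>2 * z\<close> and
  \<open>2 * w\<close> the half shifts of the transform become shifts by \<open>p\<close>.\<close>

definition cherm_pair :: "complex \<Rightarrow> nat \<Rightarrow> nat \<Rightarrow> nat \<Rightarrow> nat \<Rightarrow> complex \<Rightarrow> complex" where
  "cherm_pair p m k m' l \<zeta> = cherm m k (\<zeta> + p) * cherm m' l (\<zeta> - p)"

lemma gauss_tempered_cherm_pair: "gauss_tempered (cherm_pair p m k m' l)"
  unfolding cherm_pair_def[abs_def]
  using gauss_tempered_cherm gauss_tempered_cherm[of _ _ "- p", simplified]
  by (rule gauss_tempered_mult)

lemma has_derivative_cherm_pair:
  "(cherm_pair p m k m' l has_derivative (\<lambda>h.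
     (of_nat m * cherm_pair p (m - 1) k m' l \<zeta> + of_nat m' * cherm_pair p m k (m' - 1) l \<zeta>) * h +
     (of_nat k * cherm_pair p m (k - 1) m' l \<zeta> + of_nat l * cherm_pair p m k m' (l - 1) \<zeta>) * cnj h)) (at \<zeta>)"
proof -
  have 1: "((\<lambda>\<zeta>. \<zeta> + p) has_derivative (\<lambda>h. h)) (at \<zeta>)" "((\<lambda>\<zeta>. \<zeta> - p) has_derivative (\<lambda>h. h)) (at \<zeta>)"
    by (auto intro!: derivative_eq_intros)
  show ?thesis
    unfolding cherm_pair_def
    by (rule has_derivative_eq_rhs[OF has_derivative_mult
          [OF has_derivative_compose[OF 1(1) has_derivative_cherm]
            has_derivative_compose[OF 1(2) has_derivative_cherm]]])
      (simp add: algebra_simps)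
qed

lemma gauss_functional_cherm_pair_by_parts:
  "gauss_functional q (\<lambda>\<zeta>. \<zeta> * cherm_pair p m k m' l \<zeta>) = \<i> * q * gauss_functional q (cherm_pair p m k m' l)
     + of_nat k * gauss_functional q (cherm_pair p m (k - 1) m' l)
     + of_nat l * gauss_functional q (cherm_pair p m k m' (l - 1))" (is ?A)
  "gauss_functional q (\<lambda>\<zeta>. cnj \<zeta> * cherm_pair p m k m' l \<zeta>) = \<i> * cnj q * gauss_functional q (cherm_pair p m k m' l)
     + of_nat m * gauss_functional q (cherm_pair p (m - 1) k m' l)
     + of_nat m' * gauss_functional q (cherm_pair p m k (m' - 1) l)" (is ?B)
proof -
  note t = gauss_tempered_intros gauss_tempered_cherm_pair
  note P = gauss_functional_by_parts[OF gauss_tempered_cherm_pair _ _ has_derivative_cherm_pair]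
  show ?A
    by (subst P(1)) (simp_all add: t gauss_functional_add gauss_functional_cmult)
  show ?B
    by (subst P(2)) (simp_all add: t gauss_functional_add gauss_functional_cmult)
qed

text \<open>In the first two rules, integration by parts lowers \<open>k\<close> and
  \<open>l\<close> in turn. The term from the raised factor itself cancels against its recurrence
  and the one from the other factor survives, so \<open>m\<close> couples with \<open>l\<close> and
  \<open>m'\<close> with \<open>k\<close>. In the last two rules nothing is lowered, because both
  first indices are 0.\<close>

lemma gauss_functional_cherm_pair_Suc:
  "gauss_functional q (cherm_pair p (Suc m) k m' l) =
     (p + \<i> * q) * gauss_functional q (cherm_pair p m k m' l)
     + of_nat l * gauss_functional q (cherm_pair p m k m' (l - 1))" (is ?A)
  "gauss_functional q (cherm_pair p m k (Suc m') l) =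
     (\<i> * q - p) * gauss_functional q (cherm_pair p m k m' l)
     + of_nat k * gauss_functional q (cherm_pair p m (k - 1) m' l)" (is ?B)
  "gauss_functional q (cherm_pair p 0 (Suc k) 0 l) =
     (\<i> * cnj q + cnj p) * gauss_functional q (cherm_pair p 0 k 0 l)" (is ?C)
  "gauss_functional q (cherm_pair p 0 k 0 (Suc l)) =
     (\<i> * cnj q - cnj p) * gauss_functional q (cherm_pair p 0 k 0 l)" (is ?D)
proof -
  note t = gauss_tempered_intros gauss_tempered_cherm_pair
  have "cherm_pair p (Suc m) k m' l = (\<lambda>\<zeta>. \<zeta> * cherm_pair p m k m' l \<zeta> + p * cherm_pair p m k m' l \<zeta>
      - of_nat k * cherm_pair p m (k - 1) m' l \<zeta>)"
    by (simp add: cherm_pair_def fun_eq_iff algebra_simps)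
  then show ?A
    by (simp add: gauss_functional_add gauss_functional_diff gauss_functional_cmult t
        gauss_functional_cherm_pair_by_parts algebra_simps)
  have "cherm_pair p m k (Suc m') l = (\<lambda>\<zeta>. \<zeta> * cherm_pair p m k m' l \<zeta> - p * cherm_pair p m k m' l \<zeta>
      - of_nat l * cherm_pair p m k m' (l - 1) \<zeta>)"
    by (simp add: cherm_pair_def fun_eq_iff algebra_simps)
  then show ?B
    by (simp add: gauss_functional_add gauss_functional_diff gauss_functional_cmult t
        gauss_functional_cherm_pair_by_parts algebra_simps)
  have "cherm_pair p 0 (Suc k) 0 l = (\<lambda>\<zeta>. cnj \<zeta> * cherm_pair p 0 k 0 l \<zeta> + cnj p * cherm_pair p 0 k 0 l \<zeta>)"
    by (simp add: cherm_pair_def fun_eq_iff algebra_simps)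
  then show ?C
    by (simp add: gauss_functional_add gauss_functional_cmult t
        gauss_functional_cherm_pair_by_parts algebra_simps)
  have "cherm_pair p 0 k 0 (Suc l) = (\<lambda>\<zeta>. cnj \<zeta> * cherm_pair p 0 k 0 l \<zeta> - cnj p * cherm_pair p 0 k 0 l \<zeta>)"
    by (simp add: cherm_pair_def fun_eq_iff algebra_simps)
  then show ?D
    by (simp add: gauss_functional_diff gauss_functional_cmult t
        gauss_functional_cherm_pair_by_parts algebra_simps)
qed

text \<open>Peel off \<open>m\<close>, then \<open>m'\<close>, and only then \<open>k\<close> and
  \<open>l\<close>, whose rules need \<open>m = m' = 0\<close>. The sign
  \<open>(-1) ^ (m' + l)\<close> converts the plus signs of the lowered terms into the minus signs
  of the recurrence for \<open>cherm\<close>.\<close>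

lemma gauss_functional_cherm_pair:
  "gauss_functional q (cherm_pair p m k m' l) =
    (-1) ^ (m' + l) * cherm m l (p + \<i> * q) * cherm m' k (p - \<i> * q) * complex_of_real (pi * exp (- (cmod q)\<^sup>2))"
proof (induction m arbitrary: k l)
  case 0
  show ?case
  proof (induction m' arbitrary: k)
    case 0
    show ?case
    proof (induction k)
      case 0
      show ?case
      proof (induction l)
        case 0
        have "cherm_pair p 0 0 0 0 = (\<lambda>_. 1)"
          by (simp add: cherm_pair_def fun_eq_iff)
        then show ?case by (simp add: gauss_functional_1)
      next
        case (Suc l)
        then show ?case
          by (simp add: gauss_functional_cherm_pair_Suc(4) algebra_simps)
      qed
    next
      case (Suc k)
      then show ?case
        by (simp add: gauss_functional_cherm_pair_Suc(3) algebra_simps)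
    qed
  next
    case (Suc m')
    show ?case
      unfolding gauss_functional_cherm_pair_Suc(2) Suc by (simp add: algebra_simps)
  qed
next
  case (Suc m)
  show ?case
    unfolding gauss_functional_cherm_pair_Suc(1) Suc
    \<comment> \<open>For positive \<open>l\<close> the sign at \<open>l - 1\<close> is opposite to
      that at \<open>l\<close>; for \<open>l = 0\<close> the lowered term vanishes.\<close>
    by (cases l) (simp_all add: algebra_simps)
qed

text \<open>The transform conjugates its second argument and thereby swaps the indices, so
  \<open>hermite_fun n m'\<close> is what contributes \<open>cherm m' n\<close>. The English formula
  has the indices m', n there; with the conventions formalized here that order would produce
  \<open>cherm m m'\<close> and \<open>cherm n n'\<close> instead.\<close>

theorem theorem3p20:
  fixes m n m' n' :: nat and z w :: complex
  shows "hermite_poly2 m n m' n' z w =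
    2 * (-1) ^ (m' + n) * complex_of_real (exp ((cmod z)\<^sup>2 + (cmod w)\<^sup>2)) *
    fourier_wigner (on_plane (hermite_fun m n')) (on_plane (hermite_fun n m')) (2 * z) (2 * w)"
proof -
  define p where "p = Complex (Re z) (Re w)"
  define q where "q = Complex (Im z) (Im w)"
  define F where "F = cherm_pair p m n' m' n"
  define E where "E = complex_of_real (exp (- (cmod p)\<^sup>2))"
  let ?G = "\<lambda>\<zeta>. E * (F \<zeta> * gauss_fourier q \<zeta>)"
  \<comment> \<open>Parallelogram law: half of |\<zeta> + p|^2 + |\<zeta> - p|^2 is |\<zeta>|^2 +
    |p|^2, and \<open>E\<close> collects the part free of \<zeta>.\<close>
  have weight: "exp (\<i> * of_real (2 * (Re \<zeta> * Im z + Im \<zeta> * Im w))) * (of_real (exp (- (cmod (\<zeta> + p))\<^sup>2 / 2)) *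
      of_real (exp (- (cmod (\<zeta> - p))\<^sup>2 / 2))) = E * gauss_fourier q \<zeta>" for \<zeta>
    unfolding E_def gauss_fourier_def exp_of_real[symmetric] exp_add[symmetric]
    by (rule arg_cong[of _ _ exp])
      (simp add: complex_eq_iff cmod_power2 p_def q_def, simp add: power2_eq_square field_simps)
  have integrand: "exp (\<i> * complex_of_real (y \<bullet> vector [Im (2 * z), Im (2 * w)])) *
      on_plane (hermite_fun m n') (y + vector [Re (2 * z), Re (2 * w)] /\<^sub>R 2) *
      cnj (on_plane (hermite_fun n m') (y - vector [Re (2 * z), Re (2 * w)] /\<^sub>R 2)) = on_plane ?G y"
    (is "?l = _") for y
  proof -
    let ?\<zeta> = "Complex (y $ 1) (y $ 2)"
    have "y \<bullet> vector [Im (2 * z), Im (2 * w)] = 2 * (Re ?\<zeta> * Im z + Im ?\<zeta> * Im w)"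
      by (simp add: inner_vec_def sum_2)
    moreover have "on_plane f (y + vector [Re (2 * z), Re (2 * w)] /\<^sub>R 2) = f (?\<zeta> + p)"
      "on_plane f (y - vector [Re (2 * z), Re (2 * w)] /\<^sub>R 2) = f (?\<zeta> - p)" for f
      unfolding on_plane_def by (rule arg_cong[of _ _ f], simp add: complex_eq_iff p_def)+
    ultimately have "?l = (exp (\<i> * of_real (2 * (Re ?\<zeta> * Im z + Im ?\<zeta> * Im w))) * (of_real (exp (- (cmod (?\<zeta> + p))\<^sup>2 / 2)) *
      of_real (exp (- (cmod (?\<zeta> - p))\<^sup>2 / 2)))) * F ?\<zeta>"
      by (simp add: hermite_fun_def hermite_poly_eq_cherm cnj_cherm F_def cherm_pair_def mult_ac del: of_real_mult of_real_add)
    then show ?thesis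
      unfolding weight on_plane_def by (simp add: mult_ac)
  qed
  have cont: "continuous_on UNIV ?G"
    using gauss_decay_cmult[OF gauss_decay_mult_gauss_fourier[OF gauss_tempered_cherm_pair]]
    unfolding F_def gauss_decay_def by blast
  have "fourier_wigner (on_plane (hermite_fun m n')) (on_plane (hermite_fun n m')) (2 * z) (2 * w) =
      1 / (2 * complex_of_real pi) * (E * gauss_functional q F)"
    unfolding fourier_wigner_def fourier_wigner2_def integrand lebesgue_integral_on_plane[OF cont]
    by (simp add: plane_integral_cmult gauss_functional_def)
  also have "gauss_functional q F = (-1) ^ (m' + n) * cherm m n (p + \<i> * q) * cherm m' n' (p - \<i> * q)
      * complex_of_real (pi * exp (- (cmod q)\<^sup>2))"
    unfolding F_def by (rule gauss_functional_cherm_pair)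
  also have "p + \<i> * q = z + \<i> * w"
    by (simp add: p_def q_def complex_eq_iff)
  also have "p - \<i> * q = cnj z + \<i> * cnj w"
    by (simp add: p_def q_def complex_eq_iff)
  finally have W: "fourier_wigner (on_plane (hermite_fun m n')) (on_plane (hermite_fun n m')) (2 * z) (2 * w) =
      (-1) ^ (m' + n) / 2 * (E * of_real (exp (- (cmod q)\<^sup>2))) * hermite_poly2 m n m' n' z w"
    by (simp add: hermite_poly2_def hermite_poly_eq_cherm)
  \<comment> \<open>Regrouping real and imaginary parts preserves the total square norm, so the
    exponential prefactor cancels both remaining Gaussians; the 2 cancels the 1/2 in
    \<open>W\<close>, and the two equal signs multiply to 1.\<close>
  have "(cmod z)\<^sup>2 + (cmod w)\<^sup>2 = (cmod p)\<^sup>2 + (cmod q)\<^sup>2"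
    by (simp add: cmod_power2 p_def q_def)
  then have "complex_of_real (exp ((cmod z)\<^sup>2 + (cmod w)\<^sup>2)) * (E * of_real (exp (- (cmod q)\<^sup>2))) = 1"
    by (simp add: E_def exp_add[symmetric] flip: of_real_mult)
  then show ?thesis
    unfolding W by (simp add: mult.assoc[symmetric] power_add[symmetric] flip: mult_2)
      (simp add: mult_ac)
qed

end
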